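(* For all BCCSP processes $p_1,p_2$: $p_1\sqsubseteq_{PW}p_2$ if and only if $\mathit{dBGO}_I(p_1)\subseteq\mathit{dBGO}_I(p_2)$.
   Context: BCCSP processes over a set $\mathit{Act}$: $p ::= \mathbf{0}\mid ap\mid p+q$; transitions $ap\xrightarrow{a}p$, and $p\xrightarrow{a}p'$ implies $p+q\xrightarrow{a}p'$ and $q+p\xrightarrow{a}p'$. $I(p)=\{a\mid\exists p'.\,p\xrightarrow{a}p'\}$. Ready simulation: a relation $R$ such that $pRq$ implies $I(p)=I(q)$ and for every $p\xrightarrow{a}p'$ there is $q\xrightarrow{a}q'$ with $p'Rq'$; $p\sqsubseteq_{RS}q$ iff such $R$ with $pRq$ exists. A process is deterministic if no reachable state has two distinct outgoing transitions with the same label. The possible worlds of $p$ are the deterministic processes $q$ with $q\sqsubseteq_{RS}p$; $PW(p)$ denotes this set and $p\sqsubseteq_{PW}q$ iff $PW(p)\subseteq PW(q)$. Branching observations: finite trees $\langle A,S\rangle$ with $A\subseteq\mathit{Act}$ and $S$ a finite set of pairs $(a,b)$, $b$ a branching observation. $\mathit{BGO}_I(p)$ is the inductively defined set of all $\langle I(p),S\rangle$ with $S$ a finite subset of $\{(a,b)\mid p\xrightarrow{a}p',\ b\in\mathit{BGO}_I(p')\}$. An observation is deterministic if at every node the pairs in the set of children carry pairwise distinct actions. $\mathit{dBGO}_I(p)$ is the set of deterministic observations in $\mathit{BGO}_I(p)$. *)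

theory Defs
  imports Main "HOL-Library.FSet"
begin

text \<open>The set \<open>Act\<close> is the type variable \<open>'a\<close>; it may be finite or infinite.\<close>

datatype 'a proc =
    Zero
  | Prefix 'a "'a proc"
  | Choice "'a proc" "'a proc"

inductive step :: "'a proc \<Rightarrow> 'a \<Rightarrow> 'a proc \<Rightarrow> bool" where
  prefix: "step (Prefix a p) a p"
| choice_left: "step p a p' \<Longrightarrow> step (Choice p q) a p'"
| choice_right: "step p a p' \<Longrightarrow> step (Choice q p) a p'"

definition initials :: "'a proc \<Rightarrow> 'a set" where
  "initials p = {a. \<exists>p'. step p a p'}"

definition ready_simulation :: "('a proc \<Rightarrow> 'a proc \<Rightarrow> bool) \<Rightarrow> bool" where
  "ready_simulation R \<longleftrightarrow>
     (\<forall>p q. R p q \<longrightarrow>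
        initials p = initials q \<and>
        (\<forall>a p'. step p a p' \<longrightarrow> (\<exists>q'. step q a q' \<and> R p' q')))"

definition RS_le :: "'a proc \<Rightarrow> 'a proc \<Rightarrow> bool" where
  "RS_le p q \<longleftrightarrow> (\<exists>R. ready_simulation R \<and> R p q)"

definition reachable :: "'a proc \<Rightarrow> 'a proc \<Rightarrow> bool" where
  "reachable = (\<lambda>p q. \<exists>a. step p a q)\<^sup>*\<^sup>*"

text \<open>Transitions form a set of triples, so two transitions with the same source and
  label are distinct iff their targets are (syntactically) distinct processes.\<close>

definition deterministic :: "'a proc \<Rightarrow> bool" where
  "deterministic p \<longleftrightarrow>
     (\<forall>q a q1 q2. reachable p q \<and> step q a q1 \<and> step q a q2 \<longrightarrow> q1 = q2)"

definition PW :: "'a proc \<Rightarrow> 'a proc set" where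
  "PW p = {q. deterministic q \<and> RS_le q p}"

definition PW_le :: "'a proc \<Rightarrow> 'a proc \<Rightarrow> bool" where
  "PW_le p q \<longleftrightarrow> PW p \<subseteq> PW q"

text \<open>In \<open>Obs A S\<close> the label \<open>A\<close> is an arbitrary set of actions, while the collection \<open>S\<close>
  of children is a finite set.\<close>

datatype 'a obs = Obs "'a set" "('a \<times> 'a obs) fset"

inductive observes :: "'a proc \<Rightarrow> 'a obs \<Rightarrow> bool" where
  "(\<And>a b. (a, b) |\<in>| S \<Longrightarrow> \<exists>p'. step p a p' \<and> observes p' b) \<Longrightarrow>
     observes p (Obs (initials p) S)"

definition BGO_I :: "'a proc \<Rightarrow> 'a obs set" where
  "BGO_I p = {b. observes p b}"

text \<open>Observations are finite trees, so the inductive reading imposes the condition at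
  exactly the nodes of the tree.\<close>

inductive det_obs :: "'a obs \<Rightarrow> bool" where
  "(\<And>a b b'. (a, b) |\<in>| S \<Longrightarrow> (a, b') |\<in>| S \<Longrightarrow> b = b') \<Longrightarrow>
   (\<And>a b. (a, b) |\<in>| S \<Longrightarrow> det_obs b) \<Longrightarrow>
     det_obs (Obs A S)"

definition dBGO_I :: "'a proc \<Rightarrow> 'a obs set" where
  "dBGO_I p = {b \<in> BGO_I p. det_obs b}"

end

theory Submission
  imports Defs
begin

text \<open>A deterministic process is determined, up to the ready simulation preorder, by its complete
  deterministic observation, which records every transition: \<open>q\<close> is ready simulated by \<open>p\<close> iff \<open>p\<close>
  has the complete observation of \<open>q\<close>. Conversely, every deterministic observation of \<open>p\<close> is an
  observation of some possible world of \<open>p\<close>, obtained by resolving the choices of \<open>p\<close> as the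
  observation prescribes and arbitrarily elsewhere.\<close>

inductive_simps step_simps [simp]:
  "step Zero a r" "step (Prefix b p) a r" "step (Choice p q) a r"

inductive_simps observes_Obs: "observes p (Obs A S)"

inductive_simps det_obs_Obs: "det_obs (Obs A S)"

lemma step_size: "step p a p' \<Longrightarrow> size p' < size p"
  by (induction rule: step.induct) auto

lemma finite_initials: "finite (initials p)"
proof (induction p)
  case (Choice p q)
  have "initials (Choice p q) = initials p \<union> initials q"
    by (auto simp: initials_def)
  with Choice show ?case by simp
qed (auto simp: initials_def)

lemma deterministic_step:
  assumes "deterministic p" "step p a p'"
  shows "deterministic p'"
  using assms unfolding deterministic_def reachable_def
  by (blast intro: converse_rtranclp_into_rtranclp)

lemma deterministic_unique:
  "deterministic p \<Longrightarrow> step p a q \<Longrightarrow> step p a r \<Longrightarrow> q = r"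
  unfolding deterministic_def reachable_def by blast

lemma deterministicI:
  assumes "\<And>a q r. step p a q \<Longrightarrow> step p a r \<Longrightarrow> q = r"
    and "\<And>a q. step p a q \<Longrightarrow> deterministic q"
  shows "deterministic p"
  unfolding deterministic_def
proof (intro allI impI, elim conjE)
  fix s a q r
  assume "reachable p s" "step s a q" "step s a r"
  from \<open>reachable p s\<close> consider "s = p" | a' p' where "step p a' p'" "reachable p' s"
    unfolding reachable_def by (auto elim: converse_rtranclpE)
  then show "q = r"
    using assms \<open>step s a q\<close> \<open>step s a r\<close> unfolding deterministic_def by cases metis+
qed

lemma RS_le_initials: "RS_le q p \<Longrightarrow> initials q = initials p"
  unfolding RS_le_def ready_simulation_def by blast

lemma RS_le_step:
  assumes "RS_le q p" "step q a q'"
  obtains p' where "step p a p'" "RS_le q' p'"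
proof -
  from assms(1) obtain R where R: "ready_simulation R" "R q p"
    unfolding RS_le_def by blast
  with assms(2) obtain p' where "step p a p'" "R q' p'"
    unfolding ready_simulation_def by blast
  with R(1) show thesis using that unfolding RS_le_def by blast
qed

text \<open>Adding the single pair \<open>(q, p)\<close> to \<open>RS_le\<close>, itself a ready
  simulation, gives a ready simulation again.\<close>

lemma RS_leI:
  assumes "initials q = initials p"
    and "\<And>a q'. step q a q' \<Longrightarrow> \<exists>p'. step p a p' \<and> RS_le q' p'"
  shows "RS_le q p"
proof -
  let ?R = "\<lambda>x y. RS_le x y \<or> x = q \<and> y = p"
  have "ready_simulation ?R"
    unfolding ready_simulation_def
    using assms by (blast dest: RS_le_initials elim: RS_le_step)
  then show ?thesis unfolding RS_le_def[of q p] by blast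
qed

text \<open>Going down the observation, the simulation matches each transition used, and equal
  initials preserve every node label.\<close>

lemma observes_RS_le:
  assumes "observes q b" "RS_le q p"
  shows "observes p b"
  using assms
proof (induction arbitrary: p rule: observes.induct)
  case (1 S q)
  then show ?case
    by (fastforce simp: observes_Obs RS_le_initials elim: RS_le_step)
qed

text \<open>Recursion on the term makes the set finite by construction. The root label is kept apart
  because a summand does not know the initials of the whole sum.\<close>

primrec children :: "'a proc \<Rightarrow> ('a \<times> 'a obs) fset" where
  "children Zero = {||}"
| "children (Prefix a p) = {|(a, Obs (initials p) (children p))|}"
| "children (Choice p q) = children p |\<union>| children q"

definition complete_obs :: "'a proc \<Rightarrow> 'a obs" where
  "complete_obs p = Obs (initials p) (children p)"

lemma children_iff:
  "(a, b) |\<in>| children p \<longleftrightarrow> (\<exists>p'. step p a p' \<and> b = complete_obs p')"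
  by (induction p) (auto simp: complete_obs_def)

lemma observes_complete_obs: "observes p (complete_obs p)"
proof (induction p rule: measure_induct_rule[of size])
  case (less p)
  then show ?case
    \<comment> \<open>Only the root is unfolded: \<open>children_iff\<close> yields
      \<open>complete_obs\<close> of successors, the form in which the induction hypothesis
      applies.\<close>
    by (subst complete_obs_def) (auto simp: observes_Obs children_iff dest: step_size)
qed

lemma det_obs_complete_obs: "deterministic p \<Longrightarrow> det_obs (complete_obs p)"
proof (induction p rule: measure_induct_rule[of size])
  case (less p)
  then show ?case
    by (subst complete_obs_def)
      (auto simp: det_obs_Obs children_iff
        dest: step_size deterministic_step deterministic_unique)
qed

lemma RS_le_iff_observes_complete_obs:
  fixes p q :: "'a proc"
  shows "RS_le q p \<longleftrightarrow> observes p (complete_obs q)"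
proof
  assume "RS_le q p"
  then show "observes p (complete_obs q)"
    using observes_RS_le observes_complete_obs by blast
next
  assume "observes p (complete_obs q)"
  \<comment> \<open>The condition itself serves as the relation: the root label gives equal
    initials, and the children cover all transitions of \<open>q\<close>.\<close>
  moreover have "ready_simulation (\<lambda>(q :: 'a proc) (p :: 'a proc). observes p (complete_obs q))"
    unfolding ready_simulation_def
  proof (intro allI impI)
    fix q p :: "'a proc"
    assume "observes p (complete_obs q)"
    then have "observes p (Obs (initials q) (children q))"
      by (simp only: complete_obs_def)
    then show "initials q = initials p \<and>
        (\<forall>a q'. step q a q' \<longrightarrow> (\<exists>p'. step p a p' \<and> observes p' (complete_obs q')))"
      unfolding observes_Obs children_iff by blast
  qed
  ultimately show "RS_le q p" unfolding RS_le_def by blast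
qed

lemma exists_sum_of_prefixes:
  assumes "finite A"
  shows "\<exists>q. \<forall>a r. step q a r \<longleftrightarrow> a \<in> A \<and> r = f a"
  using assms
proof induction
  case empty
  show ?case by (rule exI[of _ Zero]) simp
next
  case (insert x A)
  then obtain q where "\<forall>a r. step q a r \<longleftrightarrow> a \<in> A \<and> r = f a" by blast
  then show ?case by (intro exI[of _ "Choice (Prefix x (f x)) q"]) auto
qed

text \<open>Induction on the size of \<open>p\<close> rather than on \<open>b\<close>: the world
  must also offer initials that \<open>b\<close> leaves unexplored, so its construction continues
  beyond the leaves of \<open>b\<close>.\<close>

lemma observes_possible_world:
  assumes "observes p b" "det_obs b"
  shows "\<exists>q \<in> PW p. observes q b"
  using assms
proof (induction p arbitrary: b rule: measure_induct_rule[of size])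
  case (less p)
  obtain S where b: "b = Obs (initials p) S"
    using less.prems(1) by (auto elim: observes.cases)
  have "\<exists>r. \<exists>p'. step p a p' \<and> r \<in> PW p' \<and> (\<forall>c. (a, c) |\<in>| S \<longrightarrow> observes r c)"
    if "a \<in> initials p" for a
  proof (cases "\<exists>c. (a, c) |\<in>| S")
    case True
    then obtain c where c: "(a, c) |\<in>| S" by blast
    with less.prems obtain p' where "step p a p'" "observes p' c" "det_obs c"
      unfolding b observes_Obs det_obs_Obs by blast
    \<comment> \<open>As \<open>c\<close> is the only child at \<open>a\<close>, a single world of
      \<open>p'\<close> serves all children there.\<close>
    moreover from c less.prems(2) b have "\<forall>c'. (a, c') |\<in>| S \<longrightarrow> c' = c"
      by (auto simp: det_obs_Obs)
    ultimately show ?thesis using less.IH[OF step_size] by metis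
  next
    case False
    from that obtain p' where p': "step p a p'" by (auto simp: initials_def)
    \<comment> \<open>Nothing is asked below \<open>a\<close>; the childless observation is a
      default that lets the induction hypothesis supply some world of \<open>p'\<close>.\<close>
    moreover have "observes p' (Obs (initials p') {||})" "det_obs (Obs (initials p') {||})"
      by (simp_all add: observes_Obs det_obs_Obs)
    ultimately obtain r where "r \<in> PW p'"
      using less.IH[OF step_size] by blast
    with p' False show ?thesis by blast
  qed
  then have "\<exists>f. \<forall>a\<in>initials p.
      \<exists>p'. step p a p' \<and> f a \<in> PW p' \<and> (\<forall>c. (a, c) |\<in>| S \<longrightarrow> observes (f a) c)"
    by (intro bchoice) blast
  then obtain f where f: "\<And>a. a \<in> initials p \<Longrightarrow>
      \<exists>p'. step p a p' \<and> f a \<in> PW p' \<and> (\<forall>c. (a, c) |\<in>| S \<longrightarrow> observes (f a) c)"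
    by blast
  obtain q where q: "\<And>a r. step q a r \<longleftrightarrow> a \<in> initials p \<and> r = f a"
    using exists_sum_of_prefixes[OF finite_initials, of p f] by blast
  have init: "initials q = initials p" by (auto simp: initials_def[of q] q)
  have "deterministic q"
    by (rule deterministicI) (auto simp: q PW_def dest!: f)
  moreover have "RS_le q p"
    by (rule RS_leI) (auto simp: init q PW_def dest!: f)
  moreover have "observes q b"
  proof -
    have "step q a (f a) \<and> observes (f a) c" if "(a, c) |\<in>| S" for a c
    proof -
      have "a \<in> initials p"
        using less.prems(1) that unfolding b observes_Obs initials_def by blast
      with f that show ?thesis unfolding q by blast
    qed
    then show ?thesis unfolding b observes_Obs init by blast
  qed
  ultimately show ?case by (auto simp: PW_def)
qed

theorem theorem4p40:
  fixes p1 p2 :: "'a proc"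
  shows "PW_le p1 p2 \<longleftrightarrow> dBGO_I p1 \<subseteq> dBGO_I p2"
proof
  assume "PW_le p1 p2"
  then show "dBGO_I p1 \<subseteq> dBGO_I p2"
    using observes_possible_world observes_RS_le
    unfolding PW_le_def dBGO_I_def BGO_I_def PW_def by blast
next
  assume "dBGO_I p1 \<subseteq> dBGO_I p2"
  \<comment> \<open>For \<open>q\<close> in \<open>PW p1\<close>, the inclusion is applied to
    \<open>complete_obs q\<close>.\<close>
  then show "PW_le p1 p2"
    using det_obs_complete_obs
    unfolding PW_le_def PW_def dBGO_I_def BGO_I_def RS_le_iff_observes_complete_obs by blast
qed

end
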